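(* Let $T$ be a first order theory and let $\lambda<\kappa<\mu$ be cardinals. Suppose that $T$ has a universal model at $\kappa$ and that there is a model $M$ of $T$ with universe $\mu$, with a subset $A\subseteq\mu$, $|A|=\lambda$, such that $|S(A)|\ge\mu$, namely there are $\mu$ complete $1$-types over $A$. Then there is a family $\langle B_i:i<\kappa^{\lambda}\rangle\subseteq[\mu]^{\kappa}$ which covers $[\mu]^{\kappa}$, namely for every $C\in[\mu]^{\kappa}$ there is an $i<\kappa^{\lambda}$ such that $C\subseteq B_i$.
   Context: A universal model of $T$ at $\kappa$ is a model of $T$ of cardinality $\kappa$ into which every model of $T$ of cardinality at most $\kappa$ can be embedded. Here "embedding" means elementary embedding when $T$ is complete; when $T$ is not complete it means an ordinary embedding, namely a one-to-one function which preserves all relations and operations. $S(A)$ denotes the set of complete $1$-types over $A$ (in $M$). $[\mu]^{\kappa}$ is the set of subsets of $\mu$ of cardinality $\kappa$.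
   Formalization: Assumes that κ is infinite and that the language of T has at most κ symbols; when T is not complete, S(A) is taken to be the set of complete quantifier-free 1-types over A. Without these changes the claim is false. *)

theory Defs
  imports Main
begin

unbundle cardinal_syntax

section \<open>First-order languages, formulas and structures\<close>

text \<open>
  A language is a set of function symbols and a set of relation symbols with arities. The symbols
  are collected in sets, not taken to be a whole type, so that either sort may be absent;
  constants are function symbols of arity 0.
\<close>

record ('f, 'r) lang =
  Funs :: "'f set"
  Rels :: "'r set"
  farity :: "'f \<Rightarrow> nat"
  rarity :: "'r \<Rightarrow> nat"

datatype 'f trm = Var nat | App 'f "'f trm list"

datatype ('f, 'r) fm =
    Eq "'f trm" "'f trm"
  | Rel 'r "'f trm list"
  | Neg "('f, 'r) fm"
  | Conj "('f, 'r) fm" "('f, 'r) fm"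
  | Forall nat "('f, 'r) fm"

fun wf_trm :: "('f, 'r) lang \<Rightarrow> 'f trm \<Rightarrow> bool" where
  "wf_trm L (Var n) = True"
| "wf_trm L (App f ts) = (f \<in> Funs L \<and> length ts = farity L f \<and> (\<forall>t\<in>set ts. wf_trm L t))"

fun wf_fm :: "('f, 'r) lang \<Rightarrow> ('f, 'r) fm \<Rightarrow> bool" where
  "wf_fm L (Eq s t) = (wf_trm L s \<and> wf_trm L t)"
| "wf_fm L (Rel R ts) = (R \<in> Rels L \<and> length ts = rarity L R \<and> (\<forall>t\<in>set ts. wf_trm L t))"
| "wf_fm L (Neg \<phi>) = wf_fm L \<phi>"
| "wf_fm L (Conj \<phi> \<psi>) = (wf_fm L \<phi> \<and> wf_fm L \<psi>)"
| "wf_fm L (Forall n \<phi>) = wf_fm L \<phi>"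

fun fv_trm :: "'f trm \<Rightarrow> nat set" where
  "fv_trm (Var n) = {n}"
| "fv_trm (App f ts) = (\<Union>t\<in>set ts. fv_trm t)"

fun fv :: "('f, 'r) fm \<Rightarrow> nat set" where
  "fv (Eq s t) = fv_trm s \<union> fv_trm t"
| "fv (Rel R ts) = (\<Union>t\<in>set ts. fv_trm t)"
| "fv (Neg \<phi>) = fv \<phi>"
| "fv (Conj \<phi> \<psi>) = fv \<phi> \<union> fv \<psi>"
| "fv (Forall n \<phi>) = fv \<phi> - {n}"

fun qfree :: "('f, 'r) fm \<Rightarrow> bool" where
  "qfree (Eq s t) = True"
| "qfree (Rel R ts) = True"
| "qfree (Neg \<phi>) = qfree \<phi>"
| "qfree (Conj \<phi> \<psi>) = (qfree \<phi> \<and> qfree \<psi>)"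
| "qfree (Forall n \<phi>) = False"

definition sentences :: "('f, 'r) lang \<Rightarrow> ('f, 'r) fm set" where
  "sentences L = {\<phi>. wf_fm L \<phi> \<and> fv \<phi> = {}}"

record ('f, 'r, 'a) struct =
  univ :: "'a set"
  fint :: "'f \<Rightarrow> 'a list \<Rightarrow> 'a"
  rint :: "'r \<Rightarrow> 'a list \<Rightarrow> bool"

definition structure_of :: "('f, 'r) lang \<Rightarrow> ('f, 'r, 'a) struct \<Rightarrow> bool" where
  "structure_of L M \<longleftrightarrow> univ M \<noteq> {} \<and>
     (\<forall>f\<in>Funs L. \<forall>xs. set xs \<subseteq> univ M \<longrightarrow> length xs = farity L f \<longrightarrow> fint M f xs \<in> univ M)"

fun eval :: "('f, 'r, 'a) struct \<Rightarrow> (nat \<Rightarrow> 'a) \<Rightarrow> 'f trm \<Rightarrow> 'a" where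
  "eval M v (Var n) = v n"
| "eval M v (App f ts) = fint M f (map (eval M v) ts)"

fun sat :: "('f, 'r, 'a) struct \<Rightarrow> (nat \<Rightarrow> 'a) \<Rightarrow> ('f, 'r) fm \<Rightarrow> bool" where
  "sat M v (Eq s t) = (eval M v s = eval M v t)"
| "sat M v (Rel R ts) = rint M R (map (eval M v) ts)"
| "sat M v (Neg \<phi>) = (\<not> sat M v \<phi>)"
| "sat M v (Conj \<phi> \<psi>) = (sat M v \<phi> \<and> sat M v \<psi>)"
| "sat M v (Forall n \<phi>) = (\<forall>a\<in>univ M. sat M (v(n := a)) \<phi>)"

definition assignments :: "('f, 'r, 'a) struct \<Rightarrow> (nat \<Rightarrow> 'a) set" where
  "assignments M = {v. range v \<subseteq> univ M}"

definition model_of :: "('f, 'r) lang \<Rightarrow> ('f, 'r) fm set \<Rightarrow> ('f, 'r, 'a) struct \<Rightarrow> bool" where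
  "model_of L T M \<longleftrightarrow> structure_of L M \<and> (\<forall>\<phi>\<in>T. \<forall>v\<in>assignments M. sat M v \<phi>)"


section \<open>Complete theories, embeddings, universal models\<close>

text \<open>
  Logical consequence quantifies over all models, whereas a HOL quantifier ranges over models
  on a fixed type. The type of formulas has at least \<open>max \<aleph>\<^sub>0 |L|\<close> elements, so by the downward
  Loewenheim-Skolem theorem models on this type suffice.
\<close>

definition entails :: "('f, 'r) lang \<Rightarrow> ('f, 'r) fm set \<Rightarrow> ('f, 'r) fm \<Rightarrow> bool" where
  "entails L T \<phi> \<longleftrightarrow> (\<forall>M :: ('f, 'r, ('f, 'r) fm) struct. model_of L T M \<longrightarrow> model_of L {\<phi>} M)"

definition complete_theory :: "('f, 'r) lang \<Rightarrow> ('f, 'r) fm set \<Rightarrow> bool" where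
  "complete_theory L T \<longleftrightarrow> (\<forall>\<phi>\<in>sentences L. entails L T \<phi> \<or> entails L T (Neg \<phi>))"

definition embedding ::
  "('f, 'r) lang \<Rightarrow> ('f, 'r, 'a) struct \<Rightarrow> ('f, 'r, 'b) struct \<Rightarrow> ('a \<Rightarrow> 'b) \<Rightarrow> bool" where
  "embedding L M N h \<longleftrightarrow> h ` univ M \<subseteq> univ N \<and> inj_on h (univ M) \<and>
     (\<forall>f\<in>Funs L. \<forall>xs. set xs \<subseteq> univ M \<longrightarrow> length xs = farity L f \<longrightarrow>
        h (fint M f xs) = fint N f (map h xs)) \<and>
     (\<forall>R\<in>Rels L. \<forall>xs. set xs \<subseteq> univ M \<longrightarrow> length xs = rarity L R \<longrightarrow>
        (rint M R xs \<longleftrightarrow> rint N R (map h xs)))"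

definition elementary_embedding ::
  "('f, 'r) lang \<Rightarrow> ('f, 'r, 'a) struct \<Rightarrow> ('f, 'r, 'b) struct \<Rightarrow> ('a \<Rightarrow> 'b) \<Rightarrow> bool" where
  "elementary_embedding L M N h \<longleftrightarrow> h ` univ M \<subseteq> univ N \<and>
     (\<forall>\<phi>. wf_fm L \<phi> \<longrightarrow> (\<forall>v\<in>assignments M. sat M v \<phi> \<longleftrightarrow> sat N (h \<circ> v) \<phi>))"

definition theory_embedding ::
  "('f, 'r) lang \<Rightarrow> ('f, 'r) fm set \<Rightarrow> ('f, 'r, 'a) struct \<Rightarrow> ('f, 'r, 'b) struct \<Rightarrow> ('a \<Rightarrow> 'b) \<Rightarrow> bool"
  where
  "theory_embedding L T M N h \<longleftrightarrow>
     (if complete_theory L T then elementary_embedding L M N h else embedding L M N h)"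

text \<open>
  The models to be embedded live on the same type as \<open>U\<close>. Since \<open>U\<close> has \<open>\<kappa>\<close> elements, every model
  of cardinality at most \<open>\<kappa>\<close> has an isomorphic copy there.
\<close>

definition universal_model ::
  "('f, 'r) lang \<Rightarrow> ('f, 'r) fm set \<Rightarrow> 'k rel \<Rightarrow> ('f, 'r, 'u) struct \<Rightarrow> bool" where
  "universal_model L T \<kappa> U \<longleftrightarrow> model_of L T U \<and> |univ U| =o \<kappa> \<and>
     (\<forall>N :: ('f, 'r, 'u) struct.
        model_of L T N \<longrightarrow> |univ N| \<le>o \<kappa> \<longrightarrow> (\<exists>h. theory_embedding L T N U h))"


section \<open>Complete 1-types over a set of parameters\<close>

definition param_lang :: "('f, 'r) lang \<Rightarrow> 'a set \<Rightarrow> ('f + 'a, 'r) lang" where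
  "param_lang L A = \<lparr>Funs = Inl ` Funs L \<union> Inr ` A, Rels = Rels L,
     farity = case_sum (farity L) (\<lambda>_. 0), rarity = rarity L\<rparr>"

definition param_struct :: "('f, 'r, 'a) struct \<Rightarrow> ('f + 'a, 'r, 'a) struct" where
  "param_struct M = \<lparr>univ = univ M, fint = case_sum (fint M) (\<lambda>a _. a), rint = rint M\<rparr>"

text \<open>
  Types consist of formulas of the kind preserved by the embeddings in use: all formulas if \<open>T\<close>
  is complete, quantifier-free formulas otherwise. The latter cannot be replaced by all formulas.
  Let \<open>T\<close> say that \<open>E\<^sub>n\<close> (\<open>n < \<omega>\<close>) is a partial injection from a set \<open>P\<close> into its complement, the
  ranges of different \<open>E\<^sub>n\<close> being disjoint. Under ordinary embeddings \<open>T\<close> has a universal model in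
  every infinite cardinality, but the formulas \<open>\<exists>y. E\<^sub>n x y\<close> give \<open>2\<^sup>\<omega>\<close> complete types over
  \<open>{}\<close> in a suitable model, so that with all formulas the covering statement fails for
  \<open>|A| = 0\<close>, \<open>\<kappa> = \<aleph>\<^sub>0\<close>, \<open>\<mu> = \<aleph>\<^sub>1\<close>.
\<close>

definition type_formulas ::
  "('f, 'r) lang \<Rightarrow> ('f, 'r) fm set \<Rightarrow> 'a set \<Rightarrow> ('f + 'a, 'r) fm set" where
  "type_formulas L T A = {\<phi>. wf_fm (param_lang L A) \<phi> \<and> fv \<phi> \<subseteq> {0} \<and>
     (complete_theory L T \<or> qfree \<phi>)}"

definition finitely_satisfiable :: "('f, 'r, 'a) struct \<Rightarrow> ('f + 'a, 'r) fm set \<Rightarrow> bool" where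
  "finitely_satisfiable M p \<longleftrightarrow>
     (\<forall>q. q \<subseteq> p \<longrightarrow> finite q \<longrightarrow> (\<exists>a\<in>univ M. \<forall>\<phi>\<in>q. sat (param_struct M) (\<lambda>_. a) \<phi>))"

definition complete_types ::
  "('f, 'r) lang \<Rightarrow> ('f, 'r) fm set \<Rightarrow> ('f, 'r, 'a) struct \<Rightarrow> 'a set \<Rightarrow> ('f + 'a, 'r) fm set set"
  where
  "complete_types L T M A = {p. p \<subseteq> type_formulas L T A \<and> finitely_satisfiable M p \<and>
     (\<forall>\<phi>\<in>type_formulas L T A. \<phi> \<in> p \<or> Neg \<phi> \<in> p)}"


section \<open>Subsets of given cardinality\<close>

definition subsets_of_card :: "'a rel \<Rightarrow> 'k rel \<Rightarrow> 'a set set" where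
  "subsets_of_card \<mu> \<kappa> = {C. C \<subseteq> Field \<mu> \<and> |C| =o \<kappa>}"

end

theory Submission
  imports Defs "HOL.Filter"
begin

text \<open>
  The types in question are transported into a universal model \<open>U\<close>, where only few of them can
  be realised. An embedding of a model of \<open>T\<close> containing \<open>A\<close> into \<open>U\<close> restricts to a map \<open>g\<close> from
  \<open>A\<close> to \<open>univ U\<close>, and there are \<open>\<kappa> ^c \<Lambda>\<close> such maps. Index distinct types over \<open>A\<close> by the elements
  of \<open>Field \<mu>\<close>, and let \<open>R g\<close> be the set of those \<open>i\<close> whose type, with its parameters moved
  by \<open>g\<close>, is realised in \<open>U\<close>. An element of \<open>U\<close> realises at most one type
  (\<open>complete_types_eqI\<close>), so \<open>R g\<close> has at most \<open>\<kappa>\<close> elements. Given \<open>C\<close> of size \<open>\<kappa>\<close>, some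
  model of \<open>T\<close> of size at most \<open>\<kappa>\<close> contains \<open>A\<close> and realises all types with index in \<open>C\<close>; embedding
  it into \<open>U\<close> gives \<open>g\<close> with \<open>C \<subseteq> R g\<close> (\<open>types_realized_in_universal_model\<close>). Hence the sets \<open>R g\<close>
  cover, once they are enlarged to size exactly \<open>\<kappa>\<close>.

  Types need not be realised in \<open>M\<close> itself. They are realised in an ultrapower of \<open>M\<close>
  (\<open>upower_realizes\<close>, by the theorem of Los), which is then cut down to size \<open>\<kappa>\<close>
  (\<open>downward_Loewenheim_Skolem\<close>) and copied to the type of \<open>U\<close> (\<open>isomorphic_copy\<close>).
  Embeddings speak about formulas without parameters; \<open>sat_expand_preserved\<close> makes the step to
  formulas with parameters, for elementary and for ordinary embeddings.
\<close>

section \<open>Closure under finitary operations\<close>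

lemma card_of_nat_ordLeq:
  assumes "Card_order \<kappa>" "infinite (Field \<kappa>)"
  shows "|UNIV :: nat set| \<le>o \<kappa>"
  using assms infinite_iff_card_of_nat card_of_Field_ordIso ordLeq_ordIso_trans by blast

lemma card_of_image_ordLeq: "|X| \<le>o \<kappa> \<Longrightarrow> |f ` X| \<le>o \<kappa>"
  using card_of_image by (rule ordLeq_transitive)

lemma card_of_lists_ordLeq:
  fixes X :: "'a set"
  assumes \<kappa>: "Card_order \<kappa>" "infinite (Field \<kappa>)" and X: "|X| \<le>o \<kappa>"
  shows "|lists X| \<le>o \<kappa>"
proof -
  note nat = card_of_nat_ordLeq[OF \<kappa>]
  have "|{xs \<in> lists X. length xs = n}| \<le>o \<kappa>" for n
  proof (induction n)
    case 0
    have "{xs \<in> lists X. length xs = 0} = (\<lambda>_. []) ` (UNIV :: nat set)" by auto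
    moreover have "|(\<lambda>_. [] :: 'a list) ` (UNIV :: nat set)| \<le>o \<kappa>"
      by (rule card_of_image_ordLeq[OF nat])
    ultimately show ?case by simp
  next
    case (Suc n)
    have "{xs \<in> lists X. length xs = Suc n} \<subseteq> (\<lambda>(x, xs). x # xs) ` (X \<times> {xs \<in> lists X. length xs = n})"
      by (auto simp: length_Suc_conv)
    moreover have "|X \<times> {xs \<in> lists X. length xs = n}| \<le>o \<kappa>"
      using card_of_Times_ordLeq_infinite_Field \<kappa> X Suc by blast
    ultimately show ?case
      by (meson card_of_mono1 card_of_image_ordLeq ordLeq_transitive)
  qed
  moreover have "lists X = (\<Union>n. {xs \<in> lists X. length xs = n})"
    by auto
  ultimately show ?thesis
    using card_of_UNION_ordLeq_infinite_Field[OF \<kappa>(2,1) nat, of "\<lambda>n. {xs \<in> lists X. length xs = n}"]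
    by simp
qed

text \<open>
  The bounds on the numbers of terms and formulas and on the size of a Skolem hull are all instances
  of this. The closure is reached after \<open>\<omega>\<close> steps because an argument list is finite and hence
  already lies in one stage.
\<close>

lemma finitary_closure:
  fixes X :: "'x set" and F :: "('x list \<Rightarrow> 'x) set"
  assumes \<kappa>: "Card_order \<kappa>" "infinite (Field \<kappa>)"
    and X: "|X| \<le>o \<kappa>" and F: "|F| \<le>o \<kappa>"
  obtains W where "X \<subseteq> W" "|W| \<le>o \<kappa>" "\<forall>f\<in>F. \<forall>xs. set xs \<subseteq> W \<longrightarrow> f xs \<in> W"
proof -
  define step where "step W = W \<union> (\<Union>f\<in>F. f ` lists W)" for W :: "'x set"
  define S where "S n = (step ^^ n) X" for n
  note nat = card_of_nat_ordLeq[OF \<kappa>]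
  have S_Suc: "S (Suc n) = step (S n)" for n by (simp add: S_def)
  have step: "|step W| \<le>o \<kappa>" if "|W| \<le>o \<kappa>" for W
  proof -
    have "|f ` lists W| \<le>o \<kappa>" for f :: "'x list \<Rightarrow> 'x"
      by (rule card_of_image_ordLeq[OF card_of_lists_ordLeq[OF \<kappa> that]])
    then have "|\<Union>f\<in>F. f ` lists W| \<le>o \<kappa>"
      by (intro card_of_UNION_ordLeq_infinite_Field[OF \<kappa>(2,1) F]) simp
    then show ?thesis
      using card_of_Un_ordLeq_infinite_Field \<kappa> that unfolding step_def by blast
  qed
  have S_card: "|S n| \<le>o \<kappa>" for n
    by (induction n) (simp add: S_def X, simp add: S_Suc step)
  have mono: "S m \<subseteq> S n" if "m \<le> n" for m n
    using that by (rule lift_Suc_mono_le[rotated]) (auto simp: S_Suc step_def)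
  have stage: "\<exists>n. set xs \<subseteq> S n" if "set xs \<subseteq> (\<Union>n. S n)" for xs
    using that
  proof (induction xs)
    case (Cons x xs)
    then obtain m n where "x \<in> S m" "set xs \<subseteq> S n" by auto
    then have "set (x # xs) \<subseteq> S (max m n)"
      using mono[of m "max m n"] mono[of n "max m n"] by auto
    then show ?case by blast
  qed auto
  show thesis
  proof
    show "X \<subseteq> (\<Union>n. S n)" using S_def[of 0] by auto
    show "|\<Union>n. S n| \<le>o \<kappa>"
      using S_card by (intro card_of_UNION_ordLeq_infinite_Field[OF \<kappa>(2,1) nat]) simp
    show "\<forall>f\<in>F. \<forall>xs. set xs \<subseteq> (\<Union>n. S n) \<longrightarrow> f xs \<in> (\<Union>n. S n)"
    proof (intro ballI allI impI)
      fix f xs assume f: "f \<in> F" and xs: "set xs \<subseteq> (\<Union>n. S n)"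
      obtain n where "set xs \<subseteq> S n" using stage[OF xs] by blast
      then have "f xs \<in> S (Suc n)" using f by (auto simp: S_Suc step_def lists_eq_set)
      then show "f xs \<in> (\<Union>n. S n)" by blast
    qed
  qed
qed

section \<open>Ultrafilters and ultrapowers\<close>

definition ultra :: "'i filter \<Rightarrow> bool" where
  "ultra F \<longleftrightarrow> F \<noteq> bot \<and> (\<forall>P. eventually P F \<or> eventually (\<lambda>s. \<not> P s) F)"

text \<open>
  A minimal proper filter is an ultrafilter: if \<open>\<not> P\<close> does not hold eventually, adding \<open>P\<close> keeps the
  filter proper and so, by minimality, changes nothing.
\<close>

lemma ex_ultra_le:
  fixes F :: "'i filter"
  assumes F: "F \<noteq> bot"
  obtains G where "G \<le> F" "ultra G"
proof -
  let ?A = "{G. G \<noteq> bot \<and> G \<le> F}"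
  have "\<exists>m\<in>?A. \<forall>a\<in>?A. m \<ge> a \<longrightarrow> a = m"
  proof (rule predicate_Zorn)
    show "partial_order_on ?A (relation_of (\<ge>) ?A)"
      by (rule partial_order_on_relation_ofI) auto
    fix C assume C: "C \<in> Chains (relation_of (\<ge>) ?A)"
    show "\<exists>u\<in>?A. \<forall>a\<in>C. u \<le> a"
    proof (cases "C = {}")
      case True
      then show ?thesis using F by auto
    next
      case False
      have sub: "C \<subseteq> ?A" using C by (auto simp: Chains_def relation_of_def)
      have "\<exists>x\<in>C. x \<le> inf G H" if "G \<in> C" "H \<in> C" for G H
        using that C by (auto simp: Chains_def relation_of_def)
      then have "eventually (\<lambda>_. False) (Inf C) \<longleftrightarrow> (\<exists>b\<in>C. eventually (\<lambda>_. False) b)"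
        by (intro eventually_Inf_base False)
      then have "Inf C \<noteq> bot" using sub by (auto simp: trivial_limit_def)
      moreover have "Inf C \<le> F" using False sub by (auto intro: Inf_lower2)
      ultimately show ?thesis by (auto intro!: bexI[of _ "Inf C"] Inf_lower)
    qed
  qed
  then obtain G where G: "G \<noteq> bot" "G \<le> F" and max: "\<And>H. H \<noteq> bot \<Longrightarrow> H \<le> G \<Longrightarrow> H = G"
    by (blast intro: order_trans)
  have "eventually P G \<or> eventually (\<lambda>s. \<not> P s) G" for P
  proof (rule disjCI)
    assume "\<not> eventually (\<lambda>s. \<not> P s) G"
    then have "inf G (principal {s. P s}) \<noteq> bot"
      by (simp add: trivial_limit_def eventually_inf_principal)
    then have "inf G (principal {s. P s}) = G" by (intro max) auto
    then have "eventually P (inf G (principal {s. P s})) = eventually P G" by simp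
    then show "eventually P G" by (simp add: eventually_inf_principal)
  qed
  then show thesis using that G by (auto simp: ultra_def)
qed

lemma eventually_not_ultra:
  "ultra F \<Longrightarrow> eventually (\<lambda>s. \<not> P s) F \<longleftrightarrow> \<not> eventually P F"
  unfolding ultra_def by (auto dest: eventually_conj simp flip: eventually_False)

text \<open>
  Classes of functions modulo \<open>F\<close> are represented by chosen members, so that an ultrapower is
  again a structure on a function type. The representative is chosen without regard to its range;
  it takes values in \<open>univ M\<close> only for almost all \<open>s\<close>, which is what the carrier of \<open>upower\<close> asks.
\<close>

definition germ :: "'i filter \<Rightarrow> ('i \<Rightarrow> 'a) \<Rightarrow> 'i \<Rightarrow> 'a" where
  "germ F f = (SOME g. \<forall>\<^sub>F s in F. g s = f s)"

definition upower :: "'i filter \<Rightarrow> ('f, 'r, 'a) struct \<Rightarrow> ('f, 'r, 'i \<Rightarrow> 'a) struct" where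
  "upower F M = \<lparr>univ = {f. germ F f = f \<and> (\<forall>\<^sub>F s in F. f s \<in> univ M)},
     fint = \<lambda>f xs. germ F (\<lambda>s. fint M f (map (\<lambda>x. x s) xs)),
     rint = \<lambda>R xs. \<forall>\<^sub>F s in F. rint M R (map (\<lambda>x. x s) xs)\<rparr>"

lemma fint_upower: "fint (upower F M) f xs = germ F (\<lambda>s. fint M f (map (\<lambda>x. x s) xs))"
  and rint_upower: "rint (upower F M) R xs \<longleftrightarrow> (\<forall>\<^sub>F s in F. rint M R (map (\<lambda>x. x s) xs))"
  by (simp_all add: upower_def)

lemma germ_eventually: "\<forall>\<^sub>F s in F. germ F f s = f s"
  unfolding germ_def by (rule someI[of _ f]) simp

lemma germ_eq_iff: "germ F f = germ F g \<longleftrightarrow> (\<forall>\<^sub>F s in F. f s = g s)"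
proof
  assume "germ F f = germ F g"
  then show "\<forall>\<^sub>F s in F. f s = g s"
    using germ_eventually[of F f] germ_eventually[of F g] by (auto elim: eventually_elim2)
next
  assume *: "\<forall>\<^sub>F s in F. f s = g s"
  have "(\<forall>\<^sub>F s in F. h s = f s) \<longleftrightarrow> (\<forall>\<^sub>F s in F. h s = g s)" for h
    by (rule iffI; erule eventually_elim2[OF _ *]; simp)
  then show "germ F f = germ F g" by (simp add: germ_def)
qed

lemma germ_germ [simp]: "germ F (germ F f) = germ F f"
  by (simp add: germ_eq_iff germ_eventually)

lemma germ_in_upower: "\<forall>\<^sub>F s in F. f s \<in> univ M \<Longrightarrow> germ F f \<in> univ (upower F M)"
  using germ_eventually[of F f] by (auto simp: upower_def elim: eventually_elim2)

lemma eventually_list_all: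
  "(\<And>x. x \<in> set xs \<Longrightarrow> eventually (P x) F) \<Longrightarrow> \<forall>\<^sub>F s in F. \<forall>x\<in>set xs. P x s"
  by (induction xs) (auto intro: eventually_conj)

lemma eval_upower:
  assumes "\<And>n. germ F (v n) = v n"
  shows "eval (upower F M) v t = germ F (\<lambda>s. eval M (\<lambda>n. v n s) t)"
proof (induction t)
  case (Var n)
  then show ?case using assms by simp
next
  case (App f ts)
  have "\<forall>\<^sub>F s in F. \<forall>t\<in>set ts. eval (upower F M) v t s = eval M (\<lambda>n. v n s) t"
    by (intro eventually_list_all) (simp add: App germ_eventually)
  then show ?case
    by (auto simp: fint_upower germ_eq_iff o_def cong: map_cong elim!: eventually_mono)
qed

text \<open>
  The theorem of Los. The ultrafilter property serves the negation. The quantifier needs choice: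
  counterexamples in the factors are combined into one element of the ultrapower.
\<close>

lemma sat_upower:
  assumes F: "ultra F" and M: "univ M \<noteq> {}" and v: "\<And>n. germ F (v n) = v n"
  shows "sat (upower F M) v \<phi> \<longleftrightarrow> (\<forall>\<^sub>F s in F. sat M (\<lambda>n. v n s) \<phi>)"
  using v
proof (induction \<phi> arbitrary: v)
  case (Eq s t)
  then show ?case by (simp add: eval_upower germ_eq_iff)
next
  case (Rel R ts)
  have *: "\<forall>\<^sub>F s in F. \<forall>t\<in>set ts. eval (upower F M) v t s = eval M (\<lambda>n. v n s) t"
    by (intro eventually_list_all) (simp add: eval_upower[OF Rel] germ_eventually)
  have "sat (upower F M) v (Rel R ts) \<longleftrightarrow>
      (\<forall>\<^sub>F s in F. rint M R (map (\<lambda>t. eval (upower F M) v t s) ts))"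
    by (simp add: rint_upower o_def)
  also have "\<dots> \<longleftrightarrow> (\<forall>\<^sub>F s in F. rint M R (map (eval M (\<lambda>n. v n s)) ts))"
    by (rule iffI; erule eventually_elim2[OF _ *]; simp cong: map_cong)
  finally show ?case by simp
next
  case (Neg \<phi>)
  then show ?case by (simp add: eventually_not_ultra[OF F])
next
  case (Conj \<phi> \<psi>)
  then show ?case by (simp add: eventually_conj_iff)
next
  case (Forall n \<phi>)
  have upd: "(\<lambda>k. (v(n := f)) k s) = (\<lambda>k. v k s)(n := f s)" for f s by auto
  have IH: "sat (upower F M) (v(n := f)) \<phi> \<longleftrightarrow>
      (\<forall>\<^sub>F s in F. sat M ((\<lambda>k. v k s)(n := f s)) \<phi>)" if "germ F f = f" for f
  proof -
    have "germ F ((v(n := f)) k) = (v(n := f)) k" for k by (simp add: Forall.prems that)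
    from Forall.IH[OF this] show ?thesis by (simp only: upd)
  qed
  show ?case
  proof
    assume sat: "sat (upower F M) v (Forall n \<phi>)"
    \<comment> \<open>a counterexample in each factor that has one, any element of \<open>M\<close> in the others\<close>
    define f where "f s = (SOME a. a \<in> univ M \<and>
        ((\<exists>b\<in>univ M. \<not> sat M ((\<lambda>k. v k s)(n := b)) \<phi>) \<longrightarrow> \<not> sat M ((\<lambda>k. v k s)(n := a)) \<phi>))" for s
    have f: "f s \<in> univ M \<and>
        ((\<exists>b\<in>univ M. \<not> sat M ((\<lambda>k. v k s)(n := b)) \<phi>) \<longrightarrow> \<not> sat M ((\<lambda>k. v k s)(n := f s)) \<phi>)" for s
      unfolding f_def by (rule someI_ex) (use M in blast)
    have "germ F f \<in> univ (upower F M)" using f by (intro germ_in_upower) simp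
    then have "\<forall>\<^sub>F s in F. sat M ((\<lambda>k. v k s)(n := germ F f s)) \<phi>"
      using sat IH[of "germ F f"] by simp
    then show "\<forall>\<^sub>F s in F. sat M (\<lambda>k. v k s) (Forall n \<phi>)"
      using germ_eventually[of F f] by eventually_elim (use f in auto)
  next
    assume *: "\<forall>\<^sub>F s in F. sat M (\<lambda>k. v k s) (Forall n \<phi>)"
    have "sat (upower F M) (v(n := f)) \<phi>" if "f \<in> univ (upower F M)" for f
    proof -
      have "germ F f = f" "\<forall>\<^sub>F s in F. f s \<in> univ M" using that by (auto simp: upower_def)
      moreover have "\<forall>\<^sub>F s in F. sat M ((\<lambda>k. v k s)(n := f s)) \<phi>"
        using * calculation(2) by eventually_elim simp
      ultimately show ?thesis using IH by blast
    qed
    then show "sat (upower F M) v (Forall n \<phi>)" by simp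
  qed
qed

lemma structure_of_upower:
  assumes "structure_of L M"
  shows "structure_of L (upower F M)"
proof -
  obtain a where "a \<in> univ M" using assms by (auto simp: structure_of_def)
  then have "germ F (\<lambda>_. a) \<in> univ (upower F M)" by (intro germ_in_upower) simp
  moreover have "fint (upower F M) f xs \<in> univ (upower F M)"
    if f: "f \<in> Funs L" "length xs = farity L f" and xs: "set xs \<subseteq> univ (upower F M)" for f xs
  proof -
    have "\<forall>\<^sub>F s in F. \<forall>x\<in>set xs. x s \<in> univ M"
      using xs by (intro eventually_list_all) (auto simp: upower_def)
    then have "\<forall>\<^sub>F s in F. fint M f (map (\<lambda>x. x s) xs) \<in> univ M"
    proof (rule eventually_mono)
      fix s assume "\<forall>x\<in>set xs. x s \<in> univ M"
      then have "set (map (\<lambda>x. x s) xs) \<subseteq> univ M" by auto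
      then show "fint M f (map (\<lambda>x. x s) xs) \<in> univ M"
        using assms f unfolding structure_of_def by (metis length_map)
    qed
    from germ_in_upower[OF this] show ?thesis by (simp add: fint_upower)
  qed
  ultimately show ?thesis unfolding structure_of_def by blast
qed

section \<open>Formulas and elementary substructures\<close>

lemma eval_cong: "(\<And>n. n \<in> fv_trm t \<Longrightarrow> v n = w n) \<Longrightarrow> eval M v t = eval M w t"
proof (induction t)
  case (App f ts)
  then have "map (eval M v) ts = map (eval M w) ts" by auto
  then show ?case by (simp only: eval.simps)
qed simp

lemma sat_cong: "(\<And>n. n \<in> fv \<phi> \<Longrightarrow> v n = w n) \<Longrightarrow> sat M v \<phi> \<longleftrightarrow> sat M w \<phi>"
proof (induction \<phi> arbitrary: v w)
  case (Eq s t)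
  have "eval M v s = eval M w s" "eval M v t = eval M w t"
    by (rule eval_cong; simp add: Eq)+
  then show ?case by simp
next
  case (Rel R ts)
  have "eval M v t = eval M w t" if "t \<in> set ts" for t
    by (rule eval_cong) (use Rel that in auto)
  then have "map (eval M v) ts = map (eval M w) ts" by simp
  then show ?case by (simp only: sat.simps)
next
  case (Neg \<phi>)
  have "sat M v \<phi> \<longleftrightarrow> sat M w \<phi>" by (rule Neg.IH) (simp add: Neg.prems)
  then show ?case by simp
next
  case (Conj \<phi> \<psi>)
  have "sat M v \<phi> \<longleftrightarrow> sat M w \<phi>" "sat M v \<psi> \<longleftrightarrow> sat M w \<psi>"
    by (rule Conj.IH; simp add: Conj.prems)+
  then show ?case by simp
next
  case (Forall n \<phi>)
  have "sat M (v(n := a)) \<phi> \<longleftrightarrow> sat M (w(n := a)) \<phi>" for a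
    using Forall.prems by (intro Forall.IH) auto
  then show ?case by simp
qed

lemma finite_fv_trm: "finite (fv_trm t)"
  by (induction t) auto

lemma finite_fv: "finite (fv \<phi>)"
  by (induction \<phi>) (auto simp: finite_fv_trm)

lemma eval_in_univ:
  assumes "structure_of L M" "v \<in> assignments M" "wf_trm L t"
  shows "eval M v t \<in> univ M"
  using assms(3)
proof (induction t)
  case (Var n)
  then show ?case using assms(2) by (auto simp: assignments_def)
next
  case (App f ts)
  then have "set (map (eval M v) ts) \<subseteq> univ M" "f \<in> Funs L" "length (map (eval M v) ts) = farity L f"
    by auto
  then show ?case using assms(1) unfolding structure_of_def eval.simps by blast
qed

lemma assignments_upd: "v \<in> assignments M \<Longrightarrow> a \<in> univ M \<Longrightarrow> v(n := a) \<in> assignments M"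
  by (auto simp: assignments_def)

lemma assignments_comp:
  "v \<in> assignments M \<Longrightarrow> h ` univ M \<subseteq> univ N \<Longrightarrow> h \<circ> v \<in> assignments N"
  by (auto simp: assignments_def)

text \<open>
  Each \<open>v n\<close> lies in \<open>univ M\<close> almost everywhere, but infinitely many exceptional sets may exhaust the
  index set. That the formulas in \<open>T\<close> are closed makes a constant assignment available instead.
\<close>

lemma model_of_upower:
  assumes F: "ultra F" and T: "T \<subseteq> sentences L" and M: "model_of L T M"
  shows "model_of L T (upower F M)"
proof -
  have str: "structure_of L M" using M by (simp add: model_of_def)
  then obtain a where a: "a \<in> univ M" by (auto simp: structure_of_def)
  have "sat (upower F M) v \<phi>" if \<phi>: "\<phi> \<in> T" and v: "v \<in> assignments (upower F M)" for \<phi> v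
  proof -
    have "sat M (\<lambda>_. a) \<phi>" using M \<phi> a by (auto simp: model_of_def assignments_def)
    moreover have "sat M (\<lambda>_. a) \<phi> \<longleftrightarrow> sat M (\<lambda>n. v n s) \<phi>" for s
      using T \<phi> by (intro sat_cong) (auto simp: sentences_def)
    moreover have "germ F (v n) = v n" for n
      using v by (auto simp: assignments_def upower_def)
    ultimately show ?thesis using a by (subst sat_upower[OF F]) auto
  qed
  then show ?thesis using structure_of_upower[OF str] by (simp add: model_of_def)
qed

lemma model_of_elementary_embedding:
  assumes T: "T \<subseteq> sentences L" and N: "model_of L T N" and M: "structure_of L M"
    and h: "elementary_embedding L M N h"
  shows "model_of L T M"
proof -
  have "sat M v \<phi>" if "\<phi> \<in> T" "v \<in> assignments M" for \<phi> v
  proof -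
    have "wf_fm L \<phi>" using T that(1) by (auto simp: sentences_def)
    moreover have "h \<circ> v \<in> assignments N"
      by (rule assignments_comp[OF that(2)]) (use h in \<open>simp add: elementary_embedding_def\<close>)
    moreover have "sat N (h \<circ> v) \<phi>" using N that(1) calculation(2) by (simp add: model_of_def)
    ultimately show ?thesis
      using h that(2) by (simp add: elementary_embedding_def)
  qed
  then show ?thesis using M by (simp add: model_of_def)
qed

lemma card_of_wf_trms:
  fixes L :: "('f, 'r) lang"
  assumes \<kappa>: "Card_order \<kappa>" "infinite (Field \<kappa>)" and L: "|Funs L| \<le>o \<kappa>"
  shows "|{t. wf_trm L t}| \<le>o \<kappa>"
proof -
  note nat = card_of_nat_ordLeq[OF \<kappa>]
  have "|range (Var :: nat \<Rightarrow> 'f trm)| \<le>o \<kappa>" "|App ` Funs L| \<le>o \<kappa>"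
    by (rule card_of_image_ordLeq[OF nat], rule card_of_image_ordLeq[OF L])
  then obtain W :: "'f trm set" where
    W: "range Var \<subseteq> W" "|W| \<le>o \<kappa>" "\<forall>f\<in>App ` Funs L. \<forall>ts. set ts \<subseteq> W \<longrightarrow> f ts \<in> W"
    by (rule finitary_closure[OF \<kappa>])
  have "wf_trm L t \<Longrightarrow> t \<in> W" for t
  proof (induction t)
    case (Var n)
    then show ?case using W(1) by auto
  next
    case (App f ts)
    then have "f \<in> Funs L" "set ts \<subseteq> W" by auto
    then show ?case using W(3) by simp
  qed
  then have "|{t. wf_trm L t}| \<le>o |W|" by (intro card_of_mono1) auto
  then show ?thesis using W(2) ordLeq_transitive by blast
qed

lemma card_of_wf_fms:
  fixes L :: "('f, 'r) lang"
  assumes \<kappa>: "Card_order \<kappa>" "infinite (Field \<kappa>)" and L: "|Funs L| \<le>o \<kappa>" "|Rels L| \<le>o \<kappa>"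
  shows "|{\<phi>. wf_fm L \<phi>}| \<le>o \<kappa>"
proof -
  let ?t = "{t. wf_trm L t}"
  define X :: "('f, 'r) fm set"
    where "X = (\<lambda>(s, t). Eq s t) ` (?t \<times> ?t) \<union> (\<lambda>(R, ts). Rel R ts) ` (Rels L \<times> lists ?t)"
  define F :: "(('f, 'r) fm list \<Rightarrow> ('f, 'r) fm) set"
    where "F = range (\<lambda>n. case n of 0 \<Rightarrow> \<lambda>\<phi>s. Neg (hd \<phi>s) | Suc 0 \<Rightarrow> \<lambda>\<phi>s. Conj (hd \<phi>s) (\<phi>s ! 1)
      | Suc (Suc n) \<Rightarrow> \<lambda>\<phi>s. Forall n (hd \<phi>s))"
  note nat = card_of_nat_ordLeq[OF \<kappa>]
  have t: "|?t| \<le>o \<kappa>" using card_of_wf_trms[OF \<kappa> L(1)] .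
  have X: "|X| \<le>o \<kappa>" unfolding X_def
    by (intro card_of_Un_ordLeq_infinite_Field card_of_Times_ordLeq_infinite_Field
        card_of_image_ordLeq card_of_lists_ordLeq \<kappa> t L)
  have F: "|F| \<le>o \<kappa>" unfolding F_def
    by (rule card_of_image_ordLeq[OF nat])
  obtain W where W: "X \<subseteq> W" "|W| \<le>o \<kappa>" "\<forall>f\<in>F. \<forall>\<phi>s. set \<phi>s \<subseteq> W \<longrightarrow> f \<phi>s \<in> W"
    by (rule finitary_closure[OF \<kappa> X F])
  have closed: "Neg \<phi> \<in> W" "Conj \<phi> \<psi> \<in> W" "Forall n \<phi> \<in> W" if "\<phi> \<in> W" "\<psi> \<in> W" for \<phi> \<psi> n
  proof -
    have "(\<lambda>\<phi>s. Neg (hd \<phi>s)) \<in> F" unfolding F_def by (rule range_eqI[of _ _ 0]) simp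
    from W(3)[rule_format, OF this, of "[\<phi>]"] show "Neg \<phi> \<in> W" using that by simp
    have "(\<lambda>\<phi>s. Conj (hd \<phi>s) (\<phi>s ! 1)) \<in> F" unfolding F_def by (rule range_eqI[of _ _ 1]) simp
    from W(3)[rule_format, OF this, of "[\<phi>, \<psi>]"] show "Conj \<phi> \<psi> \<in> W" using that by simp
    have "(\<lambda>\<phi>s. Forall n (hd \<phi>s)) \<in> F" unfolding F_def
      by (rule range_eqI[of _ _ "Suc (Suc n)"]) simp
    from W(3)[rule_format, OF this, of "[\<phi>]"] show "Forall n \<phi> \<in> W" using that by simp
  qed
  have "wf_fm L \<phi> \<Longrightarrow> \<phi> \<in> W" for \<phi>
  proof (induction \<phi>)
    case (Eq s t)
    then show ?case using W(1) by (auto simp: X_def)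
  next
    case (Rel R ts)
    then have "Rel R ts \<in> X" by (force simp: X_def)
    then show ?case using W(1) by auto
  qed (auto intro: closed)
  then have "|{\<phi>. wf_fm L \<phi>}| \<le>o |W|" by (intro card_of_mono1) auto
  then show ?thesis using W(2) ordLeq_transitive by blast
qed

lemma eval_univ_update: "eval (M\<lparr>univ := W\<rparr>) v t = eval M v t"
  by (induction t) (auto cong: map_cong)

lemma Tarski_Vaught:
  assumes W: "W \<subseteq> univ M"
    and wit: "\<And>\<phi> n v. wf_fm L \<phi> \<Longrightarrow> range v \<subseteq> W \<Longrightarrow> \<exists>a\<in>univ M. \<not> sat M (v(n := a)) \<phi> \<Longrightarrow>
      \<exists>a\<in>W. \<not> sat M (v(n := a)) \<phi>"
  shows "elementary_embedding L (M\<lparr>univ := W\<rparr>) M id"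
proof -
  have "wf_fm L \<phi> \<Longrightarrow> range v \<subseteq> W \<Longrightarrow> sat (M\<lparr>univ := W\<rparr>) v \<phi> \<longleftrightarrow> sat M v \<phi>" for \<phi> v
  proof (induction \<phi> arbitrary: v)
    case (Forall n \<phi>)
    have "sat (M\<lparr>univ := W\<rparr>) (v(n := a)) \<phi> \<longleftrightarrow> sat M (v(n := a)) \<phi>" if "a \<in> W" for a
      using Forall.prems that by (intro Forall.IH) auto
    then show ?case using wit[of \<phi> v n] Forall.prems W by auto
  qed (auto simp: eval_univ_update cong: map_cong)
  then show ?thesis using W by (auto simp: elementary_embedding_def assignments_def)
qed

text \<open>
  A Skolem function takes a list of values for the variables \<open>0, 1, \<dots>\<close>. A formula has finitely
  many free variables, so a long enough initial segment of an assignment determines its truth,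
  and the hull is closed under finitary operations only.
\<close>

lemma downward_Loewenheim_Skolem:
  fixes L :: "('f, 'r) lang" and M :: "('f, 'r, 'a) struct"
  assumes \<kappa>: "Card_order \<kappa>" "infinite (Field \<kappa>)" and L: "|Funs L| \<le>o \<kappa>" "|Rels L| \<le>o \<kappa>"
    and M: "structure_of L M" and X: "X \<subseteq> univ M" "X \<noteq> {}" "|X| \<le>o \<kappa>"
  obtains W where "X \<subseteq> W" "|W| \<le>o \<kappa>" "structure_of L (M\<lparr>univ := W\<rparr>)"
    "elementary_embedding L (M\<lparr>univ := W\<rparr>) M id"
proof -
  have ne: "univ M \<noteq> {}" using M by (simp add: structure_of_def)
  define skolem where "skolem = (\<lambda>(\<phi>, n) xs. SOME a. a \<in> univ M \<and>
    ((\<exists>b\<in>univ M. \<not> sat M ((nth xs)(n := b)) \<phi>) \<longrightarrow> \<not> sat M ((nth xs)(n := a)) \<phi>))"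
  have skolem: "skolem (\<phi>, n) xs \<in> univ M \<and> ((\<exists>b\<in>univ M. \<not> sat M ((nth xs)(n := b)) \<phi>) \<longrightarrow>
      \<not> sat M ((nth xs)(n := skolem (\<phi>, n) xs)) \<phi>)" for \<phi> n xs
    unfolding skolem_def prod.case by (rule someI_ex) (use ne in blast)
  define F where "F = fint M ` Funs L \<union> skolem ` ({\<phi>. wf_fm L \<phi>} \<times> UNIV)"
  note nat = card_of_nat_ordLeq[OF \<kappa>]
  have F: "|F| \<le>o \<kappa>" unfolding F_def
    by (intro card_of_Un_ordLeq_infinite_Field card_of_Times_ordLeq_infinite_Field
        card_of_image_ordLeq card_of_wf_fms[OF \<kappa> L] nat \<kappa> L)
  obtain V where V: "X \<subseteq> V" "|V| \<le>o \<kappa>" "\<forall>f\<in>F. \<forall>xs. set xs \<subseteq> V \<longrightarrow> f xs \<in> V"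
    by (rule finitary_closure[OF \<kappa> X(3) F])
  \<comment> \<open>\<open>fint M f\<close> may leave \<open>univ M\<close> on lists of the wrong length\<close>
  define W where "W = V \<inter> univ M"
  have sk: "skolem (\<phi>, n) xs \<in> W" if "wf_fm L \<phi>" "set xs \<subseteq> W" for \<phi> n xs
    using V(3)[rule_format, of "skolem (\<phi>, n)" xs] that skolem by (auto simp: W_def F_def)
  have XW: "X \<subseteq> W" using V(1) X(1) by (auto simp: W_def)
  moreover have "|W| \<le>o \<kappa>"
    using card_of_mono1[of W V] V(2) ordLeq_transitive by (auto simp: W_def)
  moreover have "fint M f xs \<in> W" if "f \<in> Funs L" "set xs \<subseteq> W" "length xs = farity L f" for f xs
    using that M V(3)[rule_format, of "fint M f" xs] by (auto simp: W_def F_def structure_of_def)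
  then have "structure_of L (M\<lparr>univ := W\<rparr>)"
    using XW X(2) by (auto simp: structure_of_def)
  moreover have "elementary_embedding L (M\<lparr>univ := W\<rparr>) M id"
  proof (rule Tarski_Vaught)
    fix \<phi> n v assume \<phi>: "wf_fm L \<phi>" and v: "range v \<subseteq> W" and ex: "\<exists>a\<in>univ M. \<not> sat M (v(n := a)) \<phi>"
    obtain k where k: "\<And>i. i \<in> fv \<phi> \<Longrightarrow> i < k"
      using finite_fv[of \<phi>] by (meson finite_nat_set_iff_bounded)
    let ?xs = "map v [0..<k]"
    have eq: "sat M ((nth ?xs)(n := a)) \<phi> \<longleftrightarrow> sat M (v(n := a)) \<phi>" for a
      by (rule sat_cong) (use k in auto)
    have "\<not> sat M (v(n := skolem (\<phi>, n) ?xs)) \<phi>"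
      using skolem[of \<phi> n ?xs] ex unfolding eq by blast
    moreover have "skolem (\<phi>, n) ?xs \<in> W" using v by (intro sk \<phi>) auto
    ultimately show "\<exists>a\<in>W. \<not> sat M (v(n := a)) \<phi>" by blast
  qed (simp add: W_def)
  ultimately show thesis using that by blast
qed

section \<open>Embeddings and isomorphic copies\<close>

lemma eval_embedding:
  assumes h: "embedding L M N h" and M: "structure_of L M" and v: "v \<in> assignments M"
  shows "wf_trm L t \<Longrightarrow> h (eval M v t) = eval N (h \<circ> v) t"
proof (induction t)
  case (App f ts)
  let ?xs = "map (eval M v) ts"
  have "set ?xs \<subseteq> univ M" using App.prems eval_in_univ[OF M v] by auto
  moreover have "length ?xs = farity L f" "f \<in> Funs L" using App.prems by auto
  ultimately have "h (fint M f ?xs) = fint N f (map h ?xs)"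
    using h unfolding embedding_def by blast
  also have "map h ?xs = map (eval N (h \<circ> v)) ts" using App by (simp add: o_def)
  finally show ?case by (simp add: o_def)
qed simp

text \<open>
  The alternative \<open>h ` univ M = univ N\<close> covers isomorphisms, which preserve quantifiers as well.
\<close>

lemma sat_embedding:
  assumes h: "embedding L M N h" and M: "structure_of L M"
  shows "wf_fm L \<phi> \<Longrightarrow> qfree \<phi> \<or> h ` univ M = univ N \<Longrightarrow> v \<in> assignments M \<Longrightarrow>
    sat M v \<phi> \<longleftrightarrow> sat N (h \<circ> v) \<phi>"
proof (induction \<phi> arbitrary: v)
  case (Eq s t)
  then have "eval M v s \<in> univ M" "eval M v t \<in> univ M" by (auto intro: eval_in_univ[OF M])
  moreover have "inj_on h (univ M)" using h by (simp add: embedding_def)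
  ultimately show ?case using Eq.prems eval_embedding[OF h M] unfolding sat.simps wf_fm.simps
    by (metis inj_on_eq_iff)
next
  case (Rel R ts)
  let ?xs = "map (eval M v) ts"
  have "set ?xs \<subseteq> univ M" using Rel.prems eval_in_univ[OF M] by auto
  moreover have "length ?xs = rarity L R" "R \<in> Rels L" using Rel.prems by auto
  ultimately have "rint M R ?xs \<longleftrightarrow> rint N R (map h ?xs)"
    using h unfolding embedding_def by blast
  moreover have "map h ?xs = map (eval N (h \<circ> v)) ts"
    using Rel.prems by (simp add: eval_embedding[OF h M] o_def)
  ultimately show ?case by (simp only: sat.simps)
next
  case (Forall n \<phi>)
  then have surj: "univ N = h ` univ M" by simp
  have "sat M (v(n := a)) \<phi> \<longleftrightarrow> sat N ((h \<circ> v)(n := h a)) \<phi>" if "a \<in> univ M" for a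
  proof -
    have "h \<circ> v(n := a) = (h \<circ> v)(n := h a)" by auto
    moreover have "sat M (v(n := a)) \<phi> \<longleftrightarrow> sat N (h \<circ> v(n := a)) \<phi>"
      using Forall.prems that by (intro Forall.IH assignments_upd) auto
    ultimately show ?thesis by simp
  qed
  then show ?case by (simp add: surj o_def)
qed auto

lemma sat_theory_embedding:
  assumes "theory_embedding L T M N h" "structure_of L M" "wf_fm L \<phi>"
    "complete_theory L T \<or> qfree \<phi>" "v \<in> assignments M"
  shows "sat M v \<phi> \<longleftrightarrow> sat N (h \<circ> v) \<phi>"
proof (cases "complete_theory L T")
  case True
  then show ?thesis using assms(1,3,5) by (simp add: theory_embedding_def elementary_embedding_def)
next
  case False
  then show ?thesis using assms sat_embedding[of L M N h \<phi> v] by (simp add: theory_embedding_def)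
qed

lemma theory_embedding_image: "theory_embedding L T M N h \<Longrightarrow> h ` univ M \<subseteq> univ N"
  by (auto simp: theory_embedding_def elementary_embedding_def embedding_def split: if_splits)

text \<open>
  Both directions are kept: \<open>j\<close> carries the realised types over to the copy, and its inverse shows
  that the copy is a model of \<open>T\<close>.
\<close>

lemma isomorphic_copy:
  fixes N :: "('f, 'r, 'a) struct" and j :: "'a \<Rightarrow> 'b"
  assumes N: "structure_of L N" and j: "inj_on j (univ N)"
  obtains N' where "univ N' = j ` univ N" "structure_of L N'" "elementary_embedding L N N' j"
    "elementary_embedding L N' N (inv_into (univ N) j)"
proof -
  define k where "k = inv_into (univ N) j"
  define N' :: "('f, 'r, 'b) struct" where "N' = \<lparr>univ = j ` univ N,
    fint = \<lambda>f xs. j (fint N f (map k xs)), rint = \<lambda>R xs. rint N R (map k xs)\<rparr>"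
  have kj: "k (j x) = x" if "x \<in> univ N" for x using that j by (simp add: k_def)
  then have map_kj: "map (k \<circ> j) xs = xs" if "set xs \<subseteq> univ N" for xs
    using that by (intro map_idI) auto
  have k_in: "set (map k xs) \<subseteq> univ N" if "set xs \<subseteq> j ` univ N" for xs
    using that kj by auto
  have str: "structure_of L N'"
    unfolding structure_of_def
  proof (intro conjI ballI allI impI)
    show "univ N' \<noteq> {}" using N by (simp add: N'_def structure_of_def)
    fix f xs assume "f \<in> Funs L" "set xs \<subseteq> univ N'" "length xs = farity L f"
    then have "fint N f (map k xs) \<in> univ N"
      using N k_in[of xs] unfolding structure_of_def N'_def by (metis length_map select_convs(1))
    then show "fint N' f xs \<in> univ N'" by (simp add: N'_def)
  qed
  have e1: "embedding L N N' j"
    using j by (simp add: embedding_def N'_def map_kj)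
  have fint_in: "fint N f (map k xs) \<in> univ N"
    if "f \<in> Funs L" "set xs \<subseteq> j ` univ N" "length xs = farity L f" for f xs
    using N k_in[OF that(2)] that unfolding structure_of_def by (metis length_map)
  have e2: "embedding L N' N k"
    using kj fint_in by (auto simp: embedding_def N'_def inj_on_def)
  have "k ` univ N' = univ N" using kj by (force simp: N'_def)
  then have "elementary_embedding L N N' j" "elementary_embedding L N' N k"
    using sat_embedding[OF e1 N] sat_embedding[OF e2 str]
    by (auto simp: elementary_embedding_def N'_def)
  then show thesis using that[of N'] str by (simp add: N'_def k_def)
qed
section \<open>Parameters\<close>

definition expand :: "('f, 'r, 'b) struct \<Rightarrow> ('a \<Rightarrow> 'b) \<Rightarrow> ('f + 'a, 'r, 'b) struct" where
  "expand M g = \<lparr>univ = univ M, fint = case_sum (fint M) (\<lambda>a _. g a), rint = rint M\<rparr>"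

lemma param_struct_eq_expand: "param_struct M = expand M id"
  by (simp add: param_struct_def expand_def)

lemma upower_expand: "upower F (expand M g) = expand (upower F M) (\<lambda>a. germ F (\<lambda>_. g a))"
  by (auto simp: upower_def expand_def fun_eq_iff split: sum.split)

text \<open>
  Embeddings are defined for formulas without parameters, so parameters are replaced by variables.
  Doubling the old variables keeps the new ones out of the scope of every quantifier.
\<close>

fun unparam_trm :: "('a \<Rightarrow> nat) \<Rightarrow> ('f + 'a) trm \<Rightarrow> 'f trm" where
  "unparam_trm c (Var n) = Var (2 * n)"
| "unparam_trm c (App (Inl f) ts) = App f (map (unparam_trm c) ts)"
| "unparam_trm c (App (Inr a) ts) = Var (2 * c a + 1)"

fun unparam :: "('a \<Rightarrow> nat) \<Rightarrow> ('f + 'a, 'r) fm \<Rightarrow> ('f, 'r) fm" where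
  "unparam c (Eq s t) = Eq (unparam_trm c s) (unparam_trm c t)"
| "unparam c (Rel R ts) = Rel R (map (unparam_trm c) ts)"
| "unparam c (Neg \<phi>) = Neg (unparam c \<phi>)"
| "unparam c (Conj \<phi> \<psi>) = Conj (unparam c \<phi>) (unparam c \<psi>)"
| "unparam c (Forall n \<phi>) = Forall (2 * n) (unparam c \<phi>)"

definition interleave :: "(nat \<Rightarrow> 'b) \<Rightarrow> (nat \<Rightarrow> 'b) \<Rightarrow> nat \<Rightarrow> 'b" where
  "interleave v e k = (if even k then v (k div 2) else e (k div 2))"

lemma interleave_upd: "interleave (v(n := a)) e = (interleave v e)(2 * n := a)"
  by (auto simp: interleave_def fun_eq_iff)

lemma eval_unparam:
  "(\<And>a. Inr a \<in> set_trm t \<Longrightarrow> e (c a) = g a) \<Longrightarrow>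
    eval (expand M g) v t = eval M (interleave v e) (unparam_trm c t)"
proof (induction c t rule: unparam_trm.induct)
  case (1 c n)
  then show ?case by (simp add: interleave_def)
next
  case (2 c f ts)
  have "eval (expand M g) v t = eval M (interleave v e) (unparam_trm c t)" if "t \<in> set ts" for t
    by (rule "2.IH"[OF that], rule "2.prems") (use that in auto)
  then have "map (eval (expand M g) v) ts = map (eval M (interleave v e)) (map (unparam_trm c) ts)"
    by simp
  then show ?case by (simp add: expand_def del: map_map)
next
  case (3 c a ts)
  then show ?case by (simp add: interleave_def expand_def)
qed

lemma sat_unparam:
  "(\<And>a. Inr a \<in> set1_fm \<phi> \<Longrightarrow> e (c a) = g a) \<Longrightarrow>
    sat (expand M g) v \<phi> \<longleftrightarrow> sat M (interleave v e) (unparam c \<phi>)"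
proof (induction \<phi> arbitrary: v)
  case (Eq s t)
  have "eval (expand M g) v s = eval M (interleave v e) (unparam_trm c s)"
    "eval (expand M g) v t = eval M (interleave v e) (unparam_trm c t)"
    by (rule eval_unparam; simp add: Eq)+
  then show ?case by simp
next
  case (Rel R ts)
  have "eval (expand M g) v t = eval M (interleave v e) (unparam_trm c t)" if "t \<in> set ts" for t
    by (rule eval_unparam, rule Rel) (use that in auto)
  then have "map (eval (expand M g) v) ts = map (eval M (interleave v e)) (map (unparam_trm c) ts)"
    by simp
  then show ?case by (simp add: expand_def del: map_map)
next
  case (Neg \<phi>)
  have "sat (expand M g) v \<phi> \<longleftrightarrow> sat M (interleave v e) (unparam c \<phi>)"
    by (rule Neg.IH) (simp add: Neg.prems)
  then show ?case by simp
next
  case (Conj \<phi> \<psi>)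
  have "sat (expand M g) v \<phi> \<longleftrightarrow> sat M (interleave v e) (unparam c \<phi>)"
    "sat (expand M g) v \<psi> \<longleftrightarrow> sat M (interleave v e) (unparam c \<psi>)"
    by (rule Conj.IH; simp add: Conj.prems)+
  then show ?case by simp
next
  case (Forall n \<phi>)
  have "sat (expand M g) (v(n := a)) \<phi> \<longleftrightarrow> sat M ((interleave v e)(2 * n := a)) (unparam c \<phi>)" for a
    unfolding interleave_upd[symmetric] by (rule Forall.IH) (simp add: Forall.prems)
  then show ?case by (simp add: expand_def)
qed

lemma wf_unparam_trm: "wf_trm (param_lang L A) t \<Longrightarrow> wf_trm L (unparam_trm c t)"
  by (induction c t rule: unparam_trm.induct) (auto simp: param_lang_def)

lemma wf_unparam: "wf_fm (param_lang L A) \<phi> \<Longrightarrow> wf_fm L (unparam c \<phi>)"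
  by (induction \<phi>) (auto simp: wf_unparam_trm, auto simp: param_lang_def wf_unparam_trm)

lemma qfree_unparam: "qfree (unparam c \<phi>) \<longleftrightarrow> qfree \<phi>"
  by (induction \<phi>) auto

lemma symbols_trm: "finite (set_trm t)" "wf_trm L t \<Longrightarrow> set_trm t \<subseteq> Funs L"
  by (induction t) auto

lemma symbols_fm: "finite (set1_fm \<phi>)" "wf_fm L \<phi> \<Longrightarrow> set1_fm \<phi> \<subseteq> Funs L"
  by (induction \<phi>) (auto simp: symbols_trm dest: symbols_trm(2)[THEN subsetD])

text \<open>
  A map that preserves the formulas of \<open>L\<close> which are as complex as \<open>\<phi>\<close> also preserves \<open>\<phi>\<close> with
  parameters. The condition \<open>qfree \<psi> = qfree \<phi>\<close> serves elementary and ordinary embeddings at once.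
\<close>

lemma sat_expand_preserved:
  fixes \<phi> :: "('f + 'p, 'r) fm"
  assumes pres: "\<And>\<psi> w. wf_fm L \<psi> \<Longrightarrow> qfree \<psi> = qfree \<phi> \<Longrightarrow> w \<in> assignments N \<Longrightarrow>
      sat N w \<psi> \<longleftrightarrow> sat U (h \<circ> w) \<psi>"
    and \<phi>: "wf_fm (param_lang L A) \<phi>" and g: "\<And>a. a \<in> A \<Longrightarrow> g a \<in> univ N"
    and g': "\<And>a. a \<in> A \<Longrightarrow> g' a = h (g a)" and v: "v \<in> assignments N"
  shows "sat (expand N g) v \<phi> \<longleftrightarrow> sat (expand U g') (h \<circ> v) \<phi>"
proof -
  define D where "D = {a. Inr a \<in> set1_fm \<phi>}"
  have "finite D"
    using finite_vimageI[OF symbols_fm(1)[of \<phi>], of Inr] by (simp add: D_def vimage_def)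
  then obtain c :: "'p \<Rightarrow> nat" where c: "inj_on c D"
    using finite_imp_inj_to_nat_seg by blast
  have DA: "D \<subseteq> A"
    using symbols_fm(2)[OF \<phi>] by (auto simp: D_def param_lang_def)
  define e where "e k = (if k \<in> c ` D then g (inv_into D c k) else v 0)" for k
  have ec: "e (c a) = g a" if "a \<in> D" for a using that c by (simp add: e_def)
  have "e k \<in> univ N" for k
    using v g DA ec by (cases "k \<in> c ` D") (auto simp: e_def assignments_def)
  then have w: "interleave v e \<in> assignments N"
    using v by (auto simp: interleave_def assignments_def)
  have "sat (expand N g) v \<phi> \<longleftrightarrow> sat N (interleave v e) (unparam c \<phi>)"
    using ec by (intro sat_unparam) (simp add: D_def)
  also have "\<dots> \<longleftrightarrow> sat U (h \<circ> interleave v e) (unparam c \<phi>)"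
    by (rule pres) (simp_all add: wf_unparam[OF \<phi>] qfree_unparam w)
  also have "h \<circ> interleave v e = interleave (h \<circ> v) (h \<circ> e)"
    by (auto simp: interleave_def)
  also have "sat U \<dots> (unparam c \<phi>) \<longleftrightarrow> sat (expand U g') (h \<circ> v) \<phi>"
    using ec g' DA by (intro sat_unparam[symmetric]) (auto simp: D_def)
  finally show ?thesis .
qed

section \<open>Realising types\<close>

text \<open>
  The index set of the ultrapower consists of the finite sets \<open>s\<close> of formulas. An element satisfying
  \<open>s \<inter> p\<close> in coordinate \<open>s\<close> realises \<open>p\<close>, because almost every \<open>s\<close> contains a given formula. One
  ultrapower thus serves all types at once.
\<close>

lemma upower_realizes:
  fixes M :: "('f, 'r, 'a) struct" and F :: "('f + 'a, 'r) fm set filter"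
  assumes F: "ultra F" "F \<le> finite_subsets_at_top UNIV" and M: "univ M \<noteq> {}"
    and p: "finitely_satisfiable M p"
  shows "\<exists>b\<in>univ (upower F M). \<forall>\<phi>\<in>p. sat (upower F (param_struct M)) (\<lambda>_. b) \<phi>"
proof -
  have "\<exists>a\<in>univ M. finite s \<longrightarrow> (\<forall>\<phi>\<in>s \<inter> p. sat (param_struct M) (\<lambda>_. a) \<phi>)" for s
  proof (cases "finite s")
    case True
    then have "s \<inter> p \<subseteq> p" "finite (s \<inter> p)" by auto
    then show ?thesis using p unfolding finitely_satisfiable_def by blast
  next
    case False
    then show ?thesis using M by blast
  qed
  then obtain f where f: "\<And>s. f s \<in> univ M"
    "\<And>s \<phi>. finite s \<Longrightarrow> \<phi> \<in> s \<inter> p \<Longrightarrow> sat (param_struct M) (\<lambda>_. f s) \<phi>"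
    by metis
  have "sat (upower F (param_struct M)) (\<lambda>_. germ F f) \<phi>" if \<phi>: "\<phi> \<in> p" for \<phi>
  proof -
    have "\<forall>\<^sub>F s in finite_subsets_at_top UNIV. finite s \<and> \<phi> \<in> s"
      unfolding eventually_finite_subsets_at_top by (intro exI[of _ "{\<phi>}"]) auto
    then have "\<forall>\<^sub>F s in F. finite s \<and> \<phi> \<in> s" by (rule filter_leD[OF F(2)])
    then have "\<forall>\<^sub>F s in F. sat (param_struct M) (\<lambda>_. germ F f s) \<phi>"
      using germ_eventually[of F f] by eventually_elim (use f(2) \<phi> in simp)
    then show ?thesis
      using M by (subst sat_upower[OF F(1)]) (simp_all add: param_struct_def)
  qed
  moreover have "germ F f \<in> univ (upower F M)" using f(1) by (intro germ_in_upower) simp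
  ultimately show ?thesis by blast
qed

text \<open>
  The heart of the argument. The model that is embedded in \<open>U\<close> realises all types in \<open>Q\<close>, and \<open>g\<close>
  records where the embedding sends the parameters; this is the only information about the
  embedding that the images of the types depend on.
\<close>

lemma types_realized_in_universal_model:
  fixes L :: "('f, 'r) lang" and M :: "('f, 'r, 'a) struct" and U :: "('f, 'r, 'u) struct"
  assumes \<kappa>: "Card_order \<kappa>" "infinite (Field \<kappa>)" and L: "|Funs L| \<le>o \<kappa>" "|Rels L| \<le>o \<kappa>"
    and T: "T \<subseteq> sentences L" and U: "universal_model L T \<kappa> U" and M: "model_of L T M"
    and A: "A \<subseteq> univ M" "|A| \<le>o \<kappa>" and Q: "Q \<subseteq> complete_types L T M A" "|Q| \<le>o \<kappa>"
  shows "\<exists>g\<in>Func A (univ U). \<forall>p\<in>Q. \<exists>b\<in>univ U. \<forall>\<phi>\<in>p. sat (expand U g) (\<lambda>_. b) \<phi>"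
proof -
  obtain F :: "('f + 'a, 'r) fm set filter" where F: "F \<le> finite_subsets_at_top UNIV" "ultra F"
    using ex_ultra_le[OF finite_subsets_at_top_neq_bot] by blast
  define P where "P = upower F M"
  define cst where "cst a = germ F (\<lambda>_. a)" for a :: 'a
  obtain a0 where a0: "a0 \<in> univ M" using M by (auto simp: model_of_def structure_of_def)
  have cst: "cst a \<in> univ P" if "a \<in> univ M" for a
    unfolding cst_def P_def using that by (intro germ_in_upower) simp
  have P_exp: "upower F (param_struct M) = expand P cst"
    by (simp add: param_struct_eq_expand upower_expand P_def cst_def[abs_def])
  have "\<exists>b. b \<in> univ P \<and> (\<forall>\<phi>\<in>p. sat (expand P cst) (\<lambda>_. b) \<phi>)" if "p \<in> Q" for p
  proof -
    have "finitely_satisfiable M p" using that Q(1) by (auto simp: complete_types_def)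
    moreover have "univ M \<noteq> {}" using a0 by blast
    ultimately show ?thesis using upower_realizes[OF F(2,1), of M p] unfolding P_exp P_def[symmetric] by blast
  qed
  then obtain b where b: "\<And>p. p \<in> Q \<Longrightarrow> b p \<in> univ P"
    "\<And>p \<phi>. p \<in> Q \<Longrightarrow> \<phi> \<in> p \<Longrightarrow> sat (expand P cst) (\<lambda>_. b p) \<phi>"
    by metis
  have P: "model_of L T P" unfolding P_def by (rule model_of_upower[OF F(2) T M])
  then have P_str: "structure_of L P" by (simp add: model_of_def)
  \<comment> \<open>\<open>cst a0\<close> keeps \<open>X\<close> nonempty; as an image of \<open>UNIV\<close> its singleton has size at most \<open>\<kappa>\<close>\<close>
  define X where "X = (\<lambda>_. cst a0) ` (UNIV :: nat set) \<union> (cst ` A \<union> b ` Q)"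
  have "|X| \<le>o \<kappa>" unfolding X_def
    by (intro card_of_Un_ordLeq_infinite_Field card_of_image_ordLeq card_of_nat_ordLeq \<kappa> A(2) Q(2))
  moreover have "X \<subseteq> univ P" using cst a0 A(1) b(1) by (auto simp: X_def)
  moreover have "X \<noteq> {}" by (simp add: X_def)
  ultimately obtain W where W: "X \<subseteq> W" "|W| \<le>o \<kappa>" "structure_of L (P\<lparr>univ := W\<rparr>)"
    "elementary_embedding L (P\<lparr>univ := W\<rparr>) P id"
    using downward_Loewenheim_Skolem[OF \<kappa> L P_str] by blast
  define N where "N = P\<lparr>univ := W\<rparr>"
  have N_univ: "univ N = W" by (simp add: N_def)
  have N_str: "structure_of L N" and N_emb: "elementary_embedding L N P id"
    using W(3,4) by (simp_all add: N_def)
  have N: "model_of L T N" by (rule model_of_elementary_embedding[OF T P N_str N_emb])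
  have U_card: "|univ U| =o \<kappa>" using U by (simp add: universal_model_def)
  have "|W| \<le>o |univ U|" using W(2) ordIso_symmetric[OF U_card] by (rule ordLeq_ordIso_trans)
  then obtain j where j: "inj_on j W" "j ` W \<subseteq> univ U" unfolding card_of_ordLeq[symmetric] by blast
  obtain N' where N': "univ N' = j ` univ N" "structure_of L N'" "elementary_embedding L N N' j"
    "elementary_embedding L N' N (inv_into (univ N) j)"
    using isomorphic_copy[OF N_str, of j] j(1) N_univ by blast
  have "model_of L T N'" by (rule model_of_elementary_embedding[OF T N N'(2,4)])
  moreover have "|univ N'| \<le>o \<kappa>" unfolding N'(1) N_univ by (rule card_of_image_ordLeq[OF W(2)])
  ultimately obtain h where h: "theory_embedding L T N' U h"
    using U unfolding universal_model_def by blast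
  have hj: "h (j x) \<in> univ U" if "x \<in> W" for x
    using theory_embedding_image[OF h] that N'(1) N_univ by blast
  define g where "g a = (if a \<in> A then h (j (cst a)) else undefined)" for a
  have cst_W: "cst a \<in> univ N" if "a \<in> A" for a using that W(1) by (auto simp: X_def N_univ)
  have "g \<in> Func A (univ U)" using hj cst_W by (auto simp: Func_def g_def N_univ)
  moreover have "\<exists>c\<in>univ U. \<forall>\<phi>\<in>p. sat (expand U g) (\<lambda>_. c) \<phi>" if p: "p \<in> Q" for p
  proof (intro bexI ballI)
    have bW: "b p \<in> W" using p W(1) by (auto simp: X_def)
    then show "h (j (b p)) \<in> univ U" by (rule hj)
    fix \<phi> assume \<phi>: "\<phi> \<in> p"
    then have "\<phi> \<in> type_formulas L T A" using p Q(1) by (auto simp: complete_types_def)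
    then have wf: "wf_fm (param_lang L A) \<phi>" and kind: "complete_theory L T \<or> qfree \<phi>"
      by (auto simp: type_formulas_def)
    have v: "(\<lambda>_. b p) \<in> assignments N" using bW by (auto simp: assignments_def N_univ)
    have "sat (expand N cst) (\<lambda>_. b p) \<phi> \<longleftrightarrow> sat (expand P cst) (id \<circ> (\<lambda>_. b p)) \<phi>"
    proof (rule sat_expand_preserved[OF _ wf cst_W _ v])
      show "sat N w \<psi> \<longleftrightarrow> sat P (id \<circ> w) \<psi>" if "wf_fm L \<psi>" "w \<in> assignments N" for \<psi> w
        using N_emb that unfolding elementary_embedding_def by blast
    qed simp_all
    then have "sat (expand N cst) (\<lambda>_. b p) \<phi>" using b(2)[OF p \<phi>] by simp
    moreover have "sat (expand N cst) (\<lambda>_. b p) \<phi> \<longleftrightarrow> sat (expand U g) ((h \<circ> j) \<circ> (\<lambda>_. b p)) \<phi>"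
    proof (rule sat_expand_preserved[OF _ wf cst_W _ v])
      fix \<psi> w assume \<psi>: "wf_fm L \<psi>" "qfree \<psi> = qfree \<phi>" and w: "w \<in> assignments N"
      have "sat N w \<psi> \<longleftrightarrow> sat N' (j \<circ> w) \<psi>"
        using N'(3) \<psi> w unfolding elementary_embedding_def by blast
      also have "\<dots> \<longleftrightarrow> sat U (h \<circ> (j \<circ> w)) \<psi>"
        using kind \<psi>(2) by (intro sat_theory_embedding[OF h N'(2) \<psi>(1)] assignments_comp[OF w])
          (auto simp: N'(1))
      finally show "sat N w \<psi> \<longleftrightarrow> sat U (h \<circ> j \<circ> w) \<psi>" by (simp add: comp_assoc)
    qed (simp_all add: g_def)
    ultimately show "sat (expand U g) (\<lambda>_. h (j (b p))) \<phi>" by (simp add: o_def)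
  qed
  ultimately show ?thesis by blast
qed

text \<open>
  Two different complete types disagree on a formula, and no element satisfies both it and its
  negation.
\<close>

lemma complete_types_eqI:
  assumes "p \<in> complete_types L T M A" "q \<in> complete_types L T M A"
    and "\<And>\<phi>. \<phi> \<in> p \<union> q \<Longrightarrow> sat N v \<phi>"
  shows "p = q"
proof -
  have "p \<subseteq> q" if p: "p \<in> complete_types L T M A" and q: "q \<in> complete_types L T M A"
    and sat: "\<And>\<phi>. \<phi> \<in> p \<union> q \<Longrightarrow> sat N v \<phi>" for p q
  proof (rule subsetI, rule ccontr)
    fix \<phi> assume "\<phi> \<in> p" "\<phi> \<notin> q"
    then have "Neg \<phi> \<in> q" using p q by (auto simp: complete_types_def)
    then show False using sat[of \<phi>] sat[of "Neg \<phi>"] \<open>\<phi> \<in> p\<close> by simp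
  qed
  from this[OF assms(1,2)] this[OF assms(2,1)] show ?thesis using assms(3) by blast
qed

section \<open>The covering theorem\<close>

theorem mainTheorem4:
  fixes L :: "('f, 'r) lang"
    and T :: "('f, 'r) fm set"
    and \<Lambda> :: "'l rel" and \<kappa> :: "'k rel" and \<mu> :: "'a rel"
    and M :: "('f, 'r, 'a) struct"
    and A :: "'a set"
  assumes sentences: "T \<subseteq> sentences L"
    and cardinals: "Card_order \<Lambda>" "Card_order \<kappa>" "Card_order \<mu>"
    and less: "\<Lambda> <o \<kappa>" "\<kappa> <o \<mu>"
    and inf: "infinite (Field \<kappa>)"
    and lang: "|Funs L| \<le>o \<kappa>" "|Rels L| \<le>o \<kappa>"
    and universal: "\<exists>U :: ('f, 'r, 'u) struct. universal_model L T \<kappa> U"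
    and M: "model_of L T M" "univ M = Field \<mu>"
    and A: "A \<subseteq> Field \<mu>" "|A| =o \<Lambda>"
    and types: "\<mu> \<le>o |complete_types L T M A|"
  shows "\<exists>B. (\<forall>i\<in>Field (\<kappa> ^c \<Lambda>). B i \<in> subsets_of_card \<mu> \<kappa>) \<and>
             (\<forall>C\<in>subsets_of_card \<mu> \<kappa>. \<exists>i\<in>Field (\<kappa> ^c \<Lambda>). C \<subseteq> B i)"
proof -
  obtain U :: "('f, 'r, 'u) struct" where U: "universal_model L T \<kappa> U" using universal by blast
  have U_card: "|univ U| =o \<kappa>" using U by (simp add: universal_model_def)
  have "|Field \<mu>| \<le>o |complete_types L T M A|"
    using card_of_Field_ordIso[OF cardinals(3)] types by (rule ordIso_ordLeq_trans)
  then obtain t where t: "inj_on t (Field \<mu>)" "t ` Field \<mu> \<subseteq> complete_types L T M A"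
    unfolding card_of_ordLeq[symmetric] by blast
  define R where "R g = {i \<in> Field \<mu>. \<exists>b\<in>univ U. \<forall>\<phi>\<in>t i. sat (expand U g) (\<lambda>_. b) \<phi>}" for g
  have R_card: "|R g| \<le>o \<kappa>" for g
  proof -
    have "\<forall>i\<in>R g. \<exists>b. b \<in> univ U \<and> (\<forall>\<phi>\<in>t i. sat (expand U g) (\<lambda>_. b) \<phi>)"
      by (auto simp: R_def)
    then obtain b where b: "\<And>i. i \<in> R g \<Longrightarrow> b i \<in> univ U"
      "\<And>i \<phi>. i \<in> R g \<Longrightarrow> \<phi> \<in> t i \<Longrightarrow> sat (expand U g) (\<lambda>_. b i) \<phi>"
      by metis
    have "inj_on b (R g)"
    proof (rule inj_onI)
      fix i k assume i: "i \<in> R g" and k: "k \<in> R g" and eq: "b i = b k"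
      have "i \<in> Field \<mu>" "k \<in> Field \<mu>" using i k by (auto simp: R_def)
      moreover have "t i = t k"
      proof (rule complete_types_eqI)
        show "t i \<in> complete_types L T M A" "t k \<in> complete_types L T M A"
          using t(2) calculation by auto
        show "sat (expand U g) (\<lambda>_. b i) \<phi>" if "\<phi> \<in> t i \<union> t k" for \<phi>
          using that b(2)[OF i] b(2)[OF k] eq by auto
      qed
      ultimately show "i = k" using t(1) by (auto dest: inj_onD)
    qed
    then have "|R g| \<le>o |univ U|" using b(1) unfolding card_of_ordLeq[symmetric] by blast
    then show ?thesis using U_card by (rule ordLeq_ordIso_trans)
  qed
  \<comment> \<open>\<open>R g\<close> may have fewer than \<open>\<kappa>\<close> elements; the union with \<open>D\<close> has exactly \<open>\<kappa>\<close>\<close>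
  have "|Field \<kappa>| \<le>o |Field \<mu>|"
    by (rule card_of_mono2[OF ordLess_imp_ordLeq[OF less(2)]])
  then obtain D where D: "D \<subseteq> Field \<mu>" "|Field \<kappa>| =o |D|"
    unfolding internalize_card_of_ordLeq2[of "Field \<kappa>"] by blast
  have D_card: "|D| =o \<kappa>"
    using ordIso_symmetric[OF D(2)] card_of_Field_ordIso[OF cardinals(2)] by (rule ordIso_transitive)
  have RD: "R g \<union> D \<in> subsets_of_card \<mu> \<kappa>" for g
  proof -
    have "|R g \<union> D| \<le>o \<kappa>"
      using inf cardinals(2) R_card ordIso_imp_ordLeq[OF D_card]
      by (intro card_of_Un_ordLeq_infinite_Field)
    moreover have "|D| \<le>o |R g \<union> D|" by (rule card_of_mono1) simp
    then have "\<kappa> \<le>o |R g \<union> D|" by (rule ordIso_ordLeq_trans[OF ordIso_symmetric[OF D_card]])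
    ultimately show ?thesis
      using D(1) by (auto simp: subsets_of_card_def ordIso_iff_ordLeq R_def)
  qed
  have "|univ U| ^c |A| =o \<kappa> ^c \<Lambda>"
    by (rule cexp_cong[OF U_card A(2) cardinals(1) card_of_Card_order])
  then have "|Func A (univ U)| =o \<kappa> ^c \<Lambda>" by (simp add: cexp_def Field_card_of)
  then have "|Func A (univ U)| \<le>o |Field (\<kappa> ^c \<Lambda>)|"
    using ordIso_symmetric[OF card_of_Field_ordIso[OF Card_order_cexp]]
    by (rule ordIso_imp_ordLeq[OF ordIso_transitive])
  then obtain \<iota> where \<iota>: "inj_on \<iota> (Func A (univ U))" "\<iota> ` Func A (univ U) \<subseteq> Field (\<kappa> ^c \<Lambda>)"
    unfolding card_of_ordLeq[symmetric] by blast
  define B where "B i = R (inv_into (Func A (univ U)) \<iota> i) \<union> D" for i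
  have "\<exists>i\<in>Field (\<kappa> ^c \<Lambda>). C \<subseteq> B i" if C: "C \<in> subsets_of_card \<mu> \<kappa>" for C
  proof -
    have CF: "C \<subseteq> Field \<mu>" and "|C| \<le>o \<kappa>"
      using C ordIso_imp_ordLeq by (auto simp: subsets_of_card_def)
    have "\<exists>g\<in>Func A (univ U). \<forall>p\<in>t ` C. \<exists>b\<in>univ U. \<forall>\<phi>\<in>p. sat (expand U g) (\<lambda>_. b) \<phi>"
    proof (rule types_realized_in_universal_model[OF cardinals(2) inf lang sentences U M(1)])
      show "A \<subseteq> univ M" using A(1) M(2) by simp
      show "|A| \<le>o \<kappa>"
        by (rule ordLess_imp_ordLeq[OF ordIso_ordLess_trans[OF A(2) less(1)]])
      show "t ` C \<subseteq> complete_types L T M A" using t(2) CF by blast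
      show "|t ` C| \<le>o \<kappa>" using \<open>|C| \<le>o \<kappa>\<close> by (rule card_of_image_ordLeq)
    qed
    then obtain g where g: "g \<in> Func A (univ U)"
      "\<forall>p\<in>t ` C. \<exists>b\<in>univ U. \<forall>\<phi>\<in>p. sat (expand U g) (\<lambda>_. b) \<phi>"
      by blast
    have "C \<subseteq> R g" using g(2) CF by (auto simp: R_def)
    then have "C \<subseteq> B (\<iota> g)" using g(1) \<iota>(1) by (auto simp: B_def)
    then show ?thesis using \<iota>(2) g(1) by blast
  qed
  moreover have "\<forall>i\<in>Field (\<kappa> ^c \<Lambda>). B i \<in> subsets_of_card \<mu> \<kappa>" using RD by (simp add: B_def)
  ultimately show ?thesis by blast
qed

end
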